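(* Let $K=2$, $0<v_1<v_2$, $\eta=v_1/v_2$, let $\alpha^*\in[0,1]$ be the proportion of consumers with value $v_2$ in the aggregated market, and let $\beta\in[0,1)$ satisfy $\beta\le\min\{2\eta,2(1-\eta)\}$. Put $t^*=\frac{\eta-\beta/2}{1-\beta}$. Then the set $\mathcal S$ of achievable (consumer, producer) expected utility pairs is $$\mathcal S=\Big\{\beta\big[t^*\alpha^*(v_2-v_1),\ t^*v_1+(1-t^* )\alpha^*v_2\big]^\top+(1-\beta)s'\ :\ s'\in\mathcal S'\Big\},$$ where $$\mathcal S'=\Big\{\big[\gamma_1\alpha_1(v_2-v_1),\ \gamma_1v_1+\gamma_2\alpha_2v_2\big]^\top:\ \alpha_1\in[0,\min\{t^*,\alpha^*\}],\ \alpha_2\in[\max\{t^*,\alpha^*\},1],\ \gamma_1,\gamma_2\in[0,1],\ \gamma_1+\gamma_2=1,\ \gamma_1\alpha_1+\gamma_2\alpha_2=\alpha^*\Big\}.$$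
   Context: Values are $\mathcal V=\{v_1,v_2\}$ with $0<v_1<v_2$. A market is a probability distribution $x$ on $\mathcal V$, identified with $\alpha=x(v_2)\in[0,1]$; $\mathcal X$ is the set of all markets and $\mathrm{Unif}(\mathcal X)$ the uniform distribution on it (i.e. $\alpha$ uniform on $[0,1]$). The aggregated market is $x^*=(1-\alpha^*,\alpha^* )$. A segmentation is a finitely supported probability distribution $\sigma$ on $\mathcal X$ with $\sum_x\sigma(x)x=x^*$; $\Sigma$ is the set of segmentations. For a price $p\ge0$ and market $x$: $\mathcal U_p(p,x)=p\sum_k x(v_k)\mathbf 1(p\le v_k)$ (producer) and $\mathcal U_c(p,x)=\sum_k x(v_k)(v_k-p)\mathbf 1(p\le v_k)$ (consumer). Privacy mechanism: $\mathcal M_\beta(x)$ equals $x$ with probability $1-\beta$ and, with probability $\beta$, is an independent draw from $\mathrm{Unif}(\mathcal X)$. The producer has prior $\mathrm{Unif}(\mathcal X)$ on each segment's market; after observing $\hat x$ the posterior is $\pi_\beta(\cdot|\hat x)=(1-\beta)\delta_{\hat x}+\beta\,\mathrm{Unif}(\mathcal X)$. Put $\mathcal U_p(p|\hat x)=\mathbb E_{x\sim\pi_\beta(\cdot|\hat x)}[\mathcal U_p(p,x)]$. A price $p$ is optimal given $\hat x$ if $\mathcal U_p(p|\hat x)\ge\mathcal U_p(p'|\hat x)$ for all $p'\ge0$ (optimal prices lie in $\mathcal V$). An optimal pricing rule is a (measurable) map $\phi:\mathcal X\to\Delta(\mathcal V)$ such that for each $\hat x$ the support of $\phi(\hat x)$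 consists only of prices optimal given $\hat x$. For $\bullet\in\{p,c\}$ let $U_\bullet^\phi(x)=\mathbb E_{\hat x\sim\mathcal M_\beta(x)}\mathbb E_{q\sim\phi(\hat x)}[\mathcal U_\bullet(q,x)]$. Then $$\mathcal S=\Big\{\big[\textstyle\sum_x\sigma(x)U_c^\phi(x),\ \sum_x\sigma(x)U_p^\phi(x)\big]^\top:\ \sigma\in\Sigma,\ \phi\text{ an optimal pricing rule}\Big\}.$$ *)

theory Defs
  imports "HOL-Probability.Probability"
begin

definition markets :: "real set \<Rightarrow> real pmf set" where
  "markets V = {x. set_pmf x \<subseteq> V}"

definition market_of_share :: "real \<Rightarrow> real \<Rightarrow> real \<Rightarrow> real pmf" where
  "market_of_share v1 v2 a = map_pmf (\<lambda>b. if b then v2 else v1) (bernoulli_pmf a)"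

text \<open>
  For two values, a market is identified with its share \<open>pmf x v2\<close> of high-value consumers;
  the measurable structure on markets and their uniform distribution are the ones transported
  from \<open>[0, 1]\<close> along this identification.
\<close>

definition market_algebra :: "real \<Rightarrow> real \<Rightarrow> real pmf measure" where
  "market_algebra v1 v2 = vimage_algebra (markets {v1, v2}) (\<lambda>x. pmf x v2) borel"

definition uniform_market :: "real \<Rightarrow> real \<Rightarrow> real pmf measure" where
  "uniform_market v1 v2 =
     distr (uniform_measure lborel {0..1}) (market_algebra v1 v2) (market_of_share v1 v2)"

definition segmentations :: "real set \<Rightarrow> real pmf \<Rightarrow> real pmf pmf set" where
  "segmentations V xstar =
     {\<sigma>. finite (set_pmf \<sigma>) \<and> set_pmf \<sigma> \<subseteq> markets V \<and>
         (\<forall>v\<in>V. (\<Sum>x\<in>set_pmf \<sigma>. pmf \<sigma> x * pmf x v) = pmf xstar v)}"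

definition producer_utility :: "real set \<Rightarrow> real \<Rightarrow> real pmf \<Rightarrow> real" where
  "producer_utility V p x = p * (\<Sum>v\<in>V. pmf x v * of_bool (p \<le> v))"

definition consumer_utility :: "real set \<Rightarrow> real \<Rightarrow> real pmf \<Rightarrow> real" where
  "consumer_utility V p x = (\<Sum>v\<in>V. pmf x v * (v - p) * of_bool (p \<le> v))"

text \<open>
  The convex combination of \<open>M\<close> with weight \<open>1 - \<beta>\<close> and \<open>N\<close> with weight \<open>\<beta>\<close>.  It is
  meaningful for \<open>0 \<le> \<beta> \<le> 1\<close> (outside this range \<open>bernoulli_pmf\<close> clips its parameter) and for
  probability measures \<open>M\<close> and \<open>N\<close> on the same measurable space.
\<close>

definition mixture :: "real \<Rightarrow> 'a measure \<Rightarrow> 'a measure \<Rightarrow> 'a measure" where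
  "mixture \<beta> M N = measure_pmf (bernoulli_pmf \<beta>) \<bind> (\<lambda>b. if b then N else M)"

definition mechanism :: "real \<Rightarrow> real \<Rightarrow> real \<Rightarrow> real pmf \<Rightarrow> real pmf measure" where
  "mechanism v1 v2 \<beta> x = mixture \<beta> (return (market_algebra v1 v2) x) (uniform_market v1 v2)"

text \<open>
  Under the uniform prior on markets, the posterior after observing \<open>xh\<close> is again a mixture of
  the point mass at the observation with the uniform distribution.
\<close>

definition posterior :: "real \<Rightarrow> real \<Rightarrow> real \<Rightarrow> real pmf \<Rightarrow> real pmf measure" where
  "posterior v1 v2 \<beta> xh = mixture \<beta> (return (market_algebra v1 v2) xh) (uniform_market v1 v2)"

definition posterior_producer_utility :: "real \<Rightarrow> real \<Rightarrow> real \<Rightarrow> real \<Rightarrow> real pmf \<Rightarrow> real" where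
  "posterior_producer_utility v1 v2 \<beta> p xh =
     (LINT x | posterior v1 v2 \<beta> xh. producer_utility {v1, v2} p x)"

definition optimal_price :: "real \<Rightarrow> real \<Rightarrow> real \<Rightarrow> real pmf \<Rightarrow> real \<Rightarrow> bool" where
  "optimal_price v1 v2 \<beta> xh p \<longleftrightarrow> 0 \<le> p \<and>
     (\<forall>p'\<ge>0. posterior_producer_utility v1 v2 \<beta> p xh \<ge> posterior_producer_utility v1 v2 \<beta> p' xh)"

text \<open>
  Pricing rules matter only on \<open>markets {v1, v2}\<close>, the space of \<open>market_algebra v1 v2\<close>.
\<close>

definition optimal_pricing_rules :: "real \<Rightarrow> real \<Rightarrow> real \<Rightarrow> (real pmf \<Rightarrow> real pmf) set" where
  "optimal_pricing_rules v1 v2 \<beta> =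
     {\<phi>. (\<forall>q\<in>{v1, v2}. (\<lambda>xh. pmf (\<phi> xh) q) \<in> borel_measurable (market_algebra v1 v2)) \<and>
         (\<forall>xh\<in>markets {v1, v2}. set_pmf (\<phi> xh) \<subseteq> {v1, v2} \<and>
            (\<forall>q\<in>set_pmf (\<phi> xh). optimal_price v1 v2 \<beta> xh q))}"

definition expected_utility ::
    "real \<Rightarrow> real \<Rightarrow> real \<Rightarrow> (real \<Rightarrow> real pmf \<Rightarrow> real) \<Rightarrow> (real pmf \<Rightarrow> real pmf) \<Rightarrow> real pmf \<Rightarrow> real"
  where
  "expected_utility v1 v2 \<beta> u \<phi> x =
     (LINT xh | mechanism v1 v2 \<beta> x. measure_pmf.expectation (\<phi> xh) (\<lambda>q. u q x))"

text \<open>Pairs are (consumer, producer) utilities.\<close>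

definition achievable_utilities :: "real \<Rightarrow> real \<Rightarrow> real \<Rightarrow> real pmf \<Rightarrow> (real \<times> real) set" where
  "achievable_utilities v1 v2 \<beta> xstar =
     {(\<Sum>x\<in>set_pmf \<sigma>. pmf \<sigma> x * expected_utility v1 v2 \<beta> (consumer_utility {v1, v2}) \<phi> x,
       \<Sum>x\<in>set_pmf \<sigma>. pmf \<sigma> x * expected_utility v1 v2 \<beta> (producer_utility {v1, v2}) \<phi> x) |
      \<sigma> \<phi>. \<sigma> \<in> segmentations {v1, v2} xstar \<and> \<phi> \<in> optimal_pricing_rules v1 v2 \<beta>}"

end

theory Submission
  imports Defs
begin

text \<open>
  If the observed share is \<open>a\<close>, the posterior mean share is \<open>(1 - \<beta>) * a + \<beta> / 2\<close>, so \<open>v1\<close> is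
  optimal iff \<open>a \<le> tstar\<close> and \<open>v2\<close> iff \<open>a \<ge> tstar\<close>.  A redrawn market is therefore priced at
  \<open>v1\<close> with probability \<open>tstar\<close> whatever the rule does at the single share \<open>tstar\<close>, which yields the
  constant term.  The remaining term depends on a segmentation only through the mass \<open>A\<close> of consumers
  facing \<open>v1\<close> and the mass \<open>B\<close> of high-value consumers among them; the possible pairs
  \<open>(A, B)\<close> are exactly those realised by two segments with shares on either side of \<open>tstar\<close>.
\<close>

section \<open>Bernoulli and uniform distributions on the unit interval\<close>

lemma pmf_bernoulli_clip: "pmf (bernoulli_pmf a) True = min 1 (max 0 a)"
  by (simp add: bernoulli_pmf.rep_eq)

lemma prob_space_uniform_01: "prob_space (uniform_measure lborel {0..1::real})"
  by (rule prob_space_uniform_measure) auto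

lemma integral_uniform_01_id: "(LINT a|uniform_measure lborel {0..1::real}. a) = 1 / 2"
proof -
  have "uniform_measure lborel {0..1::real} = density lborel (\<lambda>a. ennreal (indicator {0..1} a))"
    unfolding uniform_measure_def by (simp add: divide_ennreal_def ennreal_indicator)
  \<comment> \<open>The exponent 1 brings the integrand into the shape of
    \<open>integral_power\<close>.\<close>
  then have "(LINT a|uniform_measure lborel {0..1::real}. a) = (LINT a|lborel. a ^ 1 * indicator {0..1} a)"
    by (simp add: integral_density mult.commute)
  also have "\<dots> = 1 / 2"
    by (subst integral_power) auto
  finally show ?thesis .
qed

lemma integral_uniform_01_indicator_lessThan:
  assumes "t \<in> {0..1::real}"
  shows "(LINT a|uniform_measure lborel {0..1::real}. indicator {..<t} a) = t"
proof -
  have "{0..1} \<inter> {..<t} = {0..<t}"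
    using assms by auto
  then show ?thesis
    using assms by simp
qed

text \<open>Passing through the expectation avoids listing the support, which is a singleton when
  \<open>s = s'\<close> or when \<open>g\<close> is 0 or 1.\<close>

lemma sum_bernoulli_segments:
  fixes s s' :: 'a and f :: "'a \<Rightarrow> real"
  assumes "g \<in> {0..1}"
  defines "\<sigma> \<equiv> map_pmf (\<lambda>b. if b then s else s') (bernoulli_pmf g)"
  shows "finite (set_pmf \<sigma>)" "(\<Sum>x\<in>set_pmf \<sigma>. pmf \<sigma> x * f x) = g * f s + (1 - g) * f s'"
proof -
  show fin: "finite (set_pmf \<sigma>)"
    by (simp add: \<sigma>_def)
  have "(\<Sum>x\<in>set_pmf \<sigma>. pmf \<sigma> x * f x) = measure_pmf.expectation \<sigma> f"
    by (subst integral_measure_pmf[OF fin]) auto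
  also have "\<dots> = g * f s + (1 - g) * f s'"
    using assms(1) by (simp add: \<sigma>_def)
  finally show "(\<Sum>x\<in>set_pmf \<sigma>. pmf \<sigma> x * f x) = g * f s + (1 - g) * f s'" .
qed

section \<open>Two-value markets, noisy mixtures and posterior revenue\<close>

locale two_values =
  fixes v1 v2 :: real
  assumes v1_pos: "0 < v1" and v1_less_v2: "v1 < v2"
begin

text \<open>The clipped form is valid for every real \<open>a\<close>, so
  \<open>market_of_share\<close> can be handled as a Borel map on the whole line.\<close>

lemma pmf_market_of_share:
  "pmf (market_of_share v1 v2 a) v2 = min 1 (max 0 a)"
proof -
  have "inj (\<lambda>b. if b then v2 else v1)"
    using v1_less_v2 by (auto simp: inj_def)
  from pmf_map_inj'[OF this, of "bernoulli_pmf a" True] show ?thesis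
    by (simp add: market_of_share_def pmf_bernoulli_clip)
qed

lemma market_of_share_in_markets: "market_of_share v1 v2 a \<in> markets {v1, v2}"
  by (auto simp: market_of_share_def markets_def)

lemma pmf_v1_eq:
  assumes "x \<in> markets {v1, v2}"
  shows "pmf x v1 = 1 - pmf x v2"
  using sum_pmf_eq_1[of "{v1, v2}" x] assms v1_less_v2 by (simp add: markets_def)

lemma expectation_markets:
  fixes f :: "real \<Rightarrow> real"
  assumes "x \<in> markets {v1, v2}"
  shows "measure_pmf.expectation x f = pmf x v1 * f v1 + (1 - pmf x v1) * f v2"
proof -
  have "measure_pmf.expectation x f = (\<Sum>q\<in>{v1, v2}. pmf x q *\<^sub>R f q)"
    by (rule integral_measure_pmf) (use assms in \<open>auto simp: markets_def\<close>)
  then show ?thesis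
    using v1_less_v2 pmf_v1_eq[OF assms] by simp
qed

lemma space_market_algebra [simp]: "space (market_algebra v1 v2) = markets {v1, v2}"
  by (simp add: market_algebra_def)

lemma measurable_share: "(\<lambda>x. pmf x v2) \<in> borel_measurable (market_algebra v1 v2)"
  unfolding market_algebra_def by (rule measurable_vimage_algebra1) auto

lemma measurable_market_of_share: "market_of_share v1 v2 \<in> measurable borel (market_algebra v1 v2)"
  unfolding market_algebra_def
  by (rule measurable_vimage_algebra2) (auto simp: market_of_share_in_markets pmf_market_of_share)

lemma prob_space_uniform_market: "prob_space (uniform_market v1 v2)"
  unfolding uniform_market_def using measurable_market_of_share
  by (intro prob_space.prob_space_distr[OF prob_space_uniform_01]) simp

text \<open>The integrands below simplify only on \<open>markets {v1, v2}\<close>; knowing the space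
  permits rewriting them there under the integral.\<close>

lemma space_mixture_uniform_market:
  "space (mixture \<beta> (return (market_algebra v1 v2) x) (uniform_market v1 v2)) = markets {v1, v2}"
proof -
  have "sets (mixture \<beta> (return (market_algebra v1 v2) x) (uniform_market v1 v2)) =
      sets (market_algebra v1 v2)"
    unfolding mixture_def by (rule sets_bind) (auto simp: uniform_market_def)
  from sets_eq_imp_space_eq[OF this] show ?thesis
    by simp
qed

text \<open>Mechanism and posterior are the same mixture, so this formula serves both. The bound on
  \<open>f\<close> is what \<open>integral_bind\<close> asks for.\<close>

lemma integral_mixture_uniform_market:
  fixes f :: "real pmf \<Rightarrow> real"
  assumes f: "f \<in> borel_measurable (market_algebra v1 v2)"
    and bound: "\<And>x. x \<in> markets {v1, v2} \<Longrightarrow> \<bar>f x\<bar> \<le> B"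
    and x0: "x0 \<in> markets {v1, v2}" and b: "\<beta> \<in> {0..1}"
  shows "(LINT x|mixture \<beta> (return (market_algebra v1 v2) x0) (uniform_market v1 v2). f x) =
    (1 - \<beta>) * f x0 + \<beta> * (LINT a|uniform_measure lborel {0..1}. f (market_of_share v1 v2 a))"
proof -
  let ?N = "\<lambda>b. if b then uniform_market v1 v2 else return (market_algebra v1 v2) x0"
  have prob: "prob_space (?N b)" for b
    using x0 prob_space_uniform_market by (auto intro: prob_space_return)
  have sets: "sets (?N b) = sets (market_algebra v1 v2)" for b
    by (simp add: uniform_market_def)
  have N: "?N \<in> measurable (measure_pmf (bernoulli_pmf \<beta>)) (subprob_algebra (market_algebra v1 v2))"
    using prob sets by (auto simp: space_subprob_algebra prob_space_imp_subprob_space simp del: if_split)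
  have "(LINT x|mixture \<beta> (return (market_algebra v1 v2) x0) (uniform_market v1 v2). f x) =
      (LINT b|measure_pmf (bernoulli_pmf \<beta>). integral\<^sup>L (?N b) f)"
    unfolding mixture_def using f _ N
  proof (rule integral_bind)
    show "\<bar>f x\<bar> \<le> B" if "x \<in> space (market_algebra v1 v2)" for x
      using bound that by simp
    show "finite_measure (measure_pmf (bernoulli_pmf \<beta>))"
      by (rule measure_pmf.finite_measure)
    show "AE b in measure_pmf (bernoulli_pmf \<beta>). emeasure (?N b) (space (?N b)) \<le> ennreal 1"
      using prob_space.emeasure_space_1[OF prob] by (simp del: if_split)
  qed
  also have "\<dots> = (1 - \<beta>) * f x0 + \<beta> * integral\<^sup>L (uniform_market v1 v2) f"
    using b x0 f by (simp add: integral_return)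
  also have "integral\<^sup>L (uniform_market v1 v2) f =
      (LINT a|uniform_measure lborel {0..1}. f (market_of_share v1 v2 a))"
    unfolding uniform_market_def using measurable_market_of_share f
    by (subst integral_distr) auto
  finally show ?thesis .
qed

lemma producer_utility_markets:
  assumes "x \<in> markets {v1, v2}" and "0 \<le> p"
  shows "producer_utility {v1, v2} p x =
    (if p \<le> v1 then p else if p \<le> v2 then p * pmf x v2 else 0)"
  using assms v1_less_v2 pmf_v1_eq[OF assms(1)]
  by (auto simp: producer_utility_def algebra_simps)

text \<open>On markets, the revenue from a fixed nonnegative price is affine in the share of high
  values. Its posterior expectation therefore depends only on the posterior mean share, in which the
  uniform part contributes 1/2.\<close>

lemma integral_posterior_share:
  assumes "xh \<in> markets {v1, v2}" and "\<beta> \<in> {0..1}"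
  shows "(LINT x|posterior v1 v2 \<beta> xh. c + d * pmf x v2) =
    c + d * ((1 - \<beta>) * pmf xh v2 + \<beta> / 2)"
proof -
  interpret U: prob_space "uniform_measure lborel {0..1::real}"
    by (rule prob_space_uniform_01)
  \<comment> \<open>The clipping in \<open>market_of_share\<close> has no effect on the unit
    interval, which carries all the mass.\<close>
  have ae: "AE a in uniform_measure lborel {0..1::real}. min 1 (max 0 a) = a"
    by (rule AE_uniform_measureI) auto
  have mean: "(LINT a|uniform_measure lborel {0..1::real}. min 1 (max 0 a)) = 1 / 2"
    unfolding integral_uniform_01_id[symmetric] by (rule integral_cong_AE) (use ae in simp_all)
  have int: "integrable (uniform_measure lborel {0..1::real}) (\<lambda>a. min 1 (max 0 a))"
    by (rule U.integrable_const_bound[where B = 1]) auto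
  have "(LINT x|posterior v1 v2 \<beta> xh. c + d * pmf x v2) =
      (1 - \<beta>) * (c + d * pmf xh v2) +
      \<beta> * (LINT a|uniform_measure lborel {0..1}. c + d * pmf (market_of_share v1 v2 a) v2)"
    unfolding posterior_def
  proof (rule integral_mixture_uniform_market)
    show "(\<lambda>x. c + d * pmf x v2) \<in> borel_measurable (market_algebra v1 v2)"
      using measurable_share by measurable
    show "\<bar>c + d * pmf x v2\<bar> \<le> \<bar>c\<bar> + \<bar>d\<bar>" for x
    proof -
      have "\<bar>d\<bar> * pmf x v2 \<le> \<bar>d\<bar> * 1"
        by (intro mult_left_mono pmf_le_1) auto
      then show ?thesis
        using abs_triangle_ineq[of c "d * pmf x v2"] by (simp add: abs_mult)
    qed
  qed (use assms in auto)
  also have "(LINT a|uniform_measure lborel {0..1}. c + d * pmf (market_of_share v1 v2 a) v2) =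
      c + d * (1 / 2)"
    using int U.prob_space by (simp add: pmf_market_of_share mean)
  finally show ?thesis
    by (simp add: algebra_simps)
qed

lemma posterior_producer_utility_eq:
  assumes "xh \<in> markets {v1, v2}" and "\<beta> \<in> {0..1}" and "0 \<le> p"
  shows "posterior_producer_utility v1 v2 \<beta> p xh =
    (if p \<le> v1 then p
     else if p \<le> v2 then p * ((1 - \<beta>) * pmf xh v2 + \<beta> / 2) else 0)"
proof -
  \<comment> \<open>The pair \<open>c\<close>, \<open>d\<close> covers three price ranges at once:
    constant revenue up to \<open>v1\<close>, revenue proportional to the share up to
    \<open>v2\<close>, and zero above.\<close>
  define c where "c = (if p \<le> v1 then p else 0)"
  define d where "d = (if p \<le> v1 \<or> v2 < p then 0 else p)"
  have sp: "space (posterior v1 v2 \<beta> xh) = markets {v1, v2}"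
    unfolding posterior_def by (rule space_mixture_uniform_market)
  have "posterior_producer_utility v1 v2 \<beta> p xh = (LINT x|posterior v1 v2 \<beta> xh. c + d * pmf x v2)"
    unfolding posterior_producer_utility_def
    by (rule Bochner_Integration.integral_cong)
       (auto simp: sp producer_utility_markets assms(3) c_def d_def)
  then show ?thesis
    using integral_posterior_share[OF assms(1,2), of c d] by (auto simp: c_def d_def)
qed

end

section \<open>Threshold form of optimal pricing and expected utilities under noise\<close>

locale noisy_two_values = two_values +
  fixes \<beta> t :: real
  assumes beta: "\<beta> \<in> {0..<1}"
    and beta_le: "\<beta> \<le> min (2 * (v1 / v2)) (2 * (1 - v1 / v2))"
    and t_def: "t = (v1 / v2 - \<beta> / 2) / (1 - \<beta>)"
begin

text \<open>The bound \<beta> \<le> 2 * (v1 / v2) gives t \<ge> 0, and \<beta> \<le> 2 * (1 - v1 /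
  v2) gives t \<le> 1. Hence \<open>t\<close> is the probability that a uniform share falls below
  \<open>t\<close>.\<close>

lemma t_range: "t \<in> {0..1}"
  using beta beta_le by (simp add: t_def field_simps)

text \<open>The threshold \<open>t\<close> solves the indifference equation between the two prices,
  and the left side increases in \<open>a\<close> because \<beta> < 1.\<close>

lemma posterior_mean_le_iff: "v2 * ((1 - \<beta>) * a + \<beta> / 2) \<le> v1 \<longleftrightarrow> a \<le> t"
  using beta v1_pos v1_less_v2 by (simp add: t_def field_simps)

lemma posterior_mean_ge_iff: "v1 \<le> v2 * ((1 - \<beta>) * a + \<beta> / 2) \<longleftrightarrow> t \<le> a"
  using beta v1_pos v1_less_v2 by (simp add: t_def field_simps)

lemma optimal_price_iff:
  assumes xh: "xh \<in> markets {v1, v2}"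
  shows "optimal_price v1 v2 \<beta> xh v1 \<longleftrightarrow> pmf xh v2 \<le> t"
    and "optimal_price v1 v2 \<beta> xh v2 \<longleftrightarrow> t \<le> pmf xh v2"
proof -
  define m where "m = (1 - \<beta>) * pmf xh v2 + \<beta> / 2"
  have m0: "0 \<le> m"
    using beta by (simp add: m_def)
  have U: "posterior_producer_utility v1 v2 \<beta> p xh =
      (if p \<le> v1 then p else if p \<le> v2 then p * m else 0)" if "0 \<le> p" for p
    using posterior_producer_utility_eq[OF xh _ that] beta by (simp add: m_def)
  have U1: "posterior_producer_utility v1 v2 \<beta> v1 xh = v1"
    and U2: "posterior_producer_utility v1 v2 \<beta> v2 xh = v2 * m"
    using U v1_pos v1_less_v2 by auto
  \<comment> \<open>A price up to \<open>v1\<close> earns at most \<open>v1\<close>, and one in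
    between can be raised to \<open>v2\<close> without losing buyers. A price above
    \<open>v2\<close> earns nothing. Only the two values need to be compared.\<close>
  have upper: "posterior_producer_utility v1 v2 \<beta> p xh \<le> max v1 (v2 * m)" if "0 \<le> p" for p
    using v1_pos mult_right_mono[OF _ m0, of p v2] by (auto simp: U[OF that] le_max_iff_disj)
  have "optimal_price v1 v2 \<beta> xh v1 \<longleftrightarrow> v2 * m \<le> v1"
    unfolding optimal_price_def using upper U1 U2 v1_pos v1_less_v2
    by (metis max.absorb1 less_imp_le order.strict_trans)
  then show "optimal_price v1 v2 \<beta> xh v1 \<longleftrightarrow> pmf xh v2 \<le> t"
    by (simp add: m_def posterior_mean_le_iff)
  have "optimal_price v1 v2 \<beta> xh v2 \<longleftrightarrow> v1 \<le> v2 * m"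
    unfolding optimal_price_def using upper U1 U2 v1_pos v1_less_v2
    by (metis max.absorb2 less_imp_le order.strict_trans)
  then show "optimal_price v1 v2 \<beta> xh v2 \<longleftrightarrow> t \<le> pmf xh v2"
    by (simp add: m_def posterior_mean_ge_iff)
qed

text \<open>The price distribution \<open>\<phi> xh\<close> lives on the same two points as a
  market, so the facts about markets apply to it. Both prices are optimal at share \<open>t\<close>,
  where the rule may randomize freely.\<close>

lemma optimal_pricing_rules_iff:
  "\<phi> \<in> optimal_pricing_rules v1 v2 \<beta> \<longleftrightarrow>
    (\<forall>q\<in>{v1, v2}. (\<lambda>xh. pmf (\<phi> xh) q) \<in> borel_measurable (market_algebra v1 v2)) \<and>
    (\<forall>xh\<in>markets {v1, v2}. \<phi> xh \<in> markets {v1, v2} \<and>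
      (pmf xh v2 < t \<longrightarrow> pmf (\<phi> xh) v1 = 1) \<and> (t < pmf xh v2 \<longrightarrow> pmf (\<phi> xh) v1 = 0))"
proof -
  have "set_pmf (\<phi> xh) \<subseteq> {v1, v2} \<and> (\<forall>q\<in>set_pmf (\<phi> xh). optimal_price v1 v2 \<beta> xh q) \<longleftrightarrow>
      \<phi> xh \<in> markets {v1, v2} \<and>
      (pmf xh v2 < t \<longrightarrow> pmf (\<phi> xh) v1 = 1) \<and> (t < pmf xh v2 \<longrightarrow> pmf (\<phi> xh) v1 = 0)"
    if xh: "xh \<in> markets {v1, v2}" for xh
  proof (cases "\<phi> xh \<in> markets {v1, v2}")
    case True
    have "(\<forall>q\<in>set_pmf (\<phi> xh). optimal_price v1 v2 \<beta> xh q) \<longleftrightarrow>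
        (\<forall>q\<in>{v1, v2}. pmf (\<phi> xh) q \<noteq> 0 \<longrightarrow> optimal_price v1 v2 \<beta> xh q)"
      using True by (auto simp: markets_def set_pmf_iff)
    also have "\<dots> \<longleftrightarrow> (pmf (\<phi> xh) v1 \<noteq> 0 \<longrightarrow> pmf xh v2 \<le> t) \<and> (pmf (\<phi> xh) v1 \<noteq> 1 \<longrightarrow> t \<le> pmf xh v2)"
      using pmf_v1_eq[OF True] by (simp add: optimal_price_iff[OF xh])
    finally show ?thesis
      using True by (auto simp: markets_def)
  qed (simp add: markets_def)
  then show ?thesis
    unfolding optimal_pricing_rules_def by auto
qed

text \<open>The choice made at share \<open>t\<close> matters only when the true market is reported,
  since a redrawn share equals \<open>t\<close> with probability zero. Leaving \<open>u\<close>
  arbitrary covers consumer and producer together.\<close>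

lemma expected_utility_eq:
  assumes phi: "\<phi> \<in> optimal_pricing_rules v1 v2 \<beta>" and x: "x \<in> markets {v1, v2}"
  shows "expected_utility v1 v2 \<beta> u \<phi> x =
    (1 - \<beta>) * (pmf (\<phi> x) v1 * u v1 x + (1 - pmf (\<phi> x) v1) * u v2 x) +
    \<beta> * (t * u v1 x + (1 - t) * u v2 x)"
proof -
  interpret U: prob_space "uniform_measure lborel {0..1::real}"
    by (rule prob_space_uniform_01)
  \<comment> \<open>The expected utility is affine in the weight on \<open>v1\<close>, which makes
    measurability and boundedness immediate.\<close>
  define f where "f xh = u v2 x + pmf (\<phi> xh) v1 * (u v1 x - u v2 x)" for xh
  have rule: "\<phi> xh \<in> markets {v1, v2}"
    "pmf xh v2 < t \<Longrightarrow> pmf (\<phi> xh) v1 = 1" "t < pmf xh v2 \<Longrightarrow> pmf (\<phi> xh) v1 = 0"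
    if "xh \<in> markets {v1, v2}" for xh
    using phi that by (auto simp: optimal_pricing_rules_iff)
  have meas_phi: "(\<lambda>xh. pmf (\<phi> xh) v1) \<in> borel_measurable (market_algebra v1 v2)"
    using phi by (simp add: optimal_pricing_rules_iff)
  then have meas: "f \<in> borel_measurable (market_algebra v1 v2)"
    unfolding f_def by measurable
  have sp: "space (mechanism v1 v2 \<beta> x) = markets {v1, v2}"
    unfolding mechanism_def by (rule space_mixture_uniform_market)
  have "expected_utility v1 v2 \<beta> u \<phi> x = (LINT xh|mechanism v1 v2 \<beta> x. f xh)"
    unfolding expected_utility_def
    by (rule Bochner_Integration.integral_cong)
       (auto simp: sp f_def expectation_markets rule(1) algebra_simps)
  also have "\<dots> = (1 - \<beta>) * f x +
      \<beta> * (LINT a|uniform_measure lborel {0..1}. f (market_of_share v1 v2 a))"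
    unfolding mechanism_def using meas
  proof (rule integral_mixture_uniform_market)
    show "\<bar>f xh\<bar> \<le> \<bar>u v2 x\<bar> + \<bar>u v1 x - u v2 x\<bar>" for xh
    proof -
      have "pmf (\<phi> xh) v1 * \<bar>u v1 x - u v2 x\<bar> \<le> 1 * \<bar>u v1 x - u v2 x\<bar>"
        by (intro mult_right_mono pmf_le_1) auto
      then show ?thesis
        using abs_triangle_ineq[of "u v2 x" "pmf (\<phi> xh) v1 * (u v1 x - u v2 x)"]
        by (simp add: f_def abs_mult)
    qed
  qed (use x beta in auto)
  also have "(LINT a|uniform_measure lborel {0..1}. f (market_of_share v1 v2 a)) =
      (LINT a|uniform_measure lborel {0..1}. u v2 x + indicator {..<t} a * (u v1 x - u v2 x))"
  proof (rule integral_cong_AE)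
    show "(\<lambda>a. f (market_of_share v1 v2 a)) \<in> borel_measurable (uniform_measure lborel {0..1})"
      using measurable_compose[OF measurable_market_of_share meas] by simp
    \<comment> \<open>Away from the null set where \<open>a = t\<close>, the rule charges
      \<open>v1\<close> exactly below the threshold.\<close>
    have "AE a in lborel. a \<in> {0..1} \<longrightarrow>
        f (market_of_share v1 v2 a) = u v2 x + indicator {..<t} a * (u v1 x - u v2 x)"
      using AE_lborel_singleton[of t]
    proof eventually_elim
      case (elim a)
      then show ?case
        using rule[OF market_of_share_in_markets, of a]
        by (cases "a < t") (auto simp: f_def pmf_market_of_share)
    qed
    then show "AE a in uniform_measure lborel {0..1}.
        f (market_of_share v1 v2 a) = u v2 x + indicator {..<t} a * (u v1 x - u v2 x)"
      by (intro AE_uniform_measureI) auto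
  qed auto
  also have "\<dots> = u v2 x + t * (u v1 x - u v2 x)"
  proof -
    have "integrable (uniform_measure lborel {0..1::real}) (indicator {..<t} :: real \<Rightarrow> real)"
      by (rule U.integrable_const_bound[where B = 1]) auto
    then show ?thesis
      using U.prob_space integral_uniform_01_indicator_lessThan[OF t_range] by simp
  qed
  finally show ?thesis
    by (simp add: f_def algebra_simps)
qed

lemma expected_consumer_utility:
  assumes "\<phi> \<in> optimal_pricing_rules v1 v2 \<beta>" and "x \<in> markets {v1, v2}"
  shows "expected_utility v1 v2 \<beta> (consumer_utility {v1, v2}) \<phi> x =
    ((1 - \<beta>) * (pmf (\<phi> x) v1 * pmf x v2) + \<beta> * t * pmf x v2) * (v2 - v1)"
  using v1_less_v2 by (simp add: expected_utility_eq[OF assms] consumer_utility_def algebra_simps)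

lemma expected_producer_utility:
  assumes "\<phi> \<in> optimal_pricing_rules v1 v2 \<beta>" and "x \<in> markets {v1, v2}"
  shows "expected_utility v1 v2 \<beta> (producer_utility {v1, v2}) \<phi> x =
    (1 - \<beta>) * (pmf (\<phi> x) v1 * v1 + (1 - pmf (\<phi> x) v1) * pmf x v2 * v2) +
    \<beta> * (t * v1 + (1 - t) * pmf x v2 * v2)"
  using v1_less_v2 v1_pos assms
  by (simp add: expected_utility_eq producer_utility_markets algebra_simps)

section \<open>Aggregation over a segmentation\<close>

definition low_price_mass :: "(real pmf \<Rightarrow> real pmf) \<Rightarrow> real pmf pmf \<Rightarrow> real" where
  "low_price_mass \<phi> \<sigma> = (\<Sum>x\<in>set_pmf \<sigma>. pmf \<sigma> x * pmf (\<phi> x) v1)"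

text \<open>This is a mass and not a conditional mean, so it remains meaningful when
  \<open>low_price_mass\<close> is 0.\<close>

definition low_price_share :: "(real pmf \<Rightarrow> real pmf) \<Rightarrow> real pmf pmf \<Rightarrow> real" where
  "low_price_share \<phi> \<sigma> = (\<Sum>x\<in>set_pmf \<sigma>. pmf \<sigma> x * (pmf (\<phi> x) v1 * pmf x v2))"

text \<open>The two shares of each market sum to 1, as do the segment weights, so the constraint for
  \<open>v1\<close> follows from the one for \<open>v2\<close>.\<close>

lemma segmentations_iff:
  assumes "a \<in> {0..1}"
  shows "\<sigma> \<in> segmentations {v1, v2} (market_of_share v1 v2 a) \<longleftrightarrow>
    finite (set_pmf \<sigma>) \<and> set_pmf \<sigma> \<subseteq> markets {v1, v2} \<and>
    (\<Sum>x\<in>set_pmf \<sigma>. pmf \<sigma> x * pmf x v2) = a"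
proof -
  have "(\<Sum>x\<in>set_pmf \<sigma>. pmf \<sigma> x * pmf x v1) = 1 - (\<Sum>x\<in>set_pmf \<sigma>. pmf \<sigma> x * pmf x v2)"
    if "finite (set_pmf \<sigma>)" "set_pmf \<sigma> \<subseteq> markets {v1, v2}"
  proof -
    have "pmf \<sigma> x * pmf x v1 = pmf \<sigma> x - pmf \<sigma> x * pmf x v2" if "x \<in> set_pmf \<sigma>" for x
      using pmf_v1_eq[of x] that \<open>set_pmf \<sigma> \<subseteq> markets {v1, v2}\<close> by (auto simp: right_diff_distrib)
    then have "(\<Sum>x\<in>set_pmf \<sigma>. pmf \<sigma> x * pmf x v1) = (\<Sum>x\<in>set_pmf \<sigma>. pmf \<sigma> x - pmf \<sigma> x * pmf x v2)"
      by simp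
    then show ?thesis
      using sum_pmf_eq_1[OF that(1), of \<sigma>] by (simp add: sum_subtractf)
  qed
  then show ?thesis
    using assms pmf_v1_eq[OF market_of_share_in_markets, of a]
    by (auto simp: segmentations_def pmf_market_of_share)
qed

lemma aggregate_utilities:
  assumes a: "a \<in> {0..1}" and phi: "\<phi> \<in> optimal_pricing_rules v1 v2 \<beta>"
    and sigma: "\<sigma> \<in> segmentations {v1, v2} (market_of_share v1 v2 a)"
  defines "A \<equiv> low_price_mass \<phi> \<sigma>" and "B \<equiv> low_price_share \<phi> \<sigma>"
  shows "(\<Sum>x\<in>set_pmf \<sigma>. pmf \<sigma> x * expected_utility v1 v2 \<beta> (consumer_utility {v1, v2}) \<phi> x) =
      \<beta> * (t * a * (v2 - v1)) + (1 - \<beta>) * (B * (v2 - v1))"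
    and "(\<Sum>x\<in>set_pmf \<sigma>. pmf \<sigma> x * expected_utility v1 v2 \<beta> (producer_utility {v1, v2}) \<phi> x) =
      \<beta> * (t * v1 + (1 - t) * a * v2) + (1 - \<beta>) * (A * v1 + (a - B) * v2)"
proof -
  note [simp] = low_price_mass_def low_price_share_def
  have fin: "finite (set_pmf \<sigma>)" and sub: "set_pmf \<sigma> \<subseteq> markets {v1, v2}"
    and mean: "(\<Sum>x\<in>set_pmf \<sigma>. pmf \<sigma> x * pmf x v2) = a"
    using sigma by (auto simp: segmentations_iff[OF a])
  have one: "(\<Sum>x\<in>set_pmf \<sigma>. pmf \<sigma> x) = 1"
    by (rule sum_pmf_eq_1[OF fin]) simp
  have "(\<Sum>x\<in>set_pmf \<sigma>. pmf \<sigma> x * expected_utility v1 v2 \<beta> (consumer_utility {v1, v2}) \<phi> x) =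
      (\<Sum>x\<in>set_pmf \<sigma>. \<beta> * t * (v2 - v1) * (pmf \<sigma> x * pmf x v2) +
        (1 - \<beta>) * (v2 - v1) * (pmf \<sigma> x * (pmf (\<phi> x) v1 * pmf x v2)))"
    by (rule sum.cong) (use sub phi in \<open>auto simp: expected_consumer_utility algebra_simps\<close>)
  also have "\<dots> = \<beta> * t * (v2 - v1) * a + (1 - \<beta>) * (v2 - v1) * B"
    by (simp add: B_def sum.distrib mean flip: sum_distrib_left)
  finally show "(\<Sum>x\<in>set_pmf \<sigma>. pmf \<sigma> x * expected_utility v1 v2 \<beta> (consumer_utility {v1, v2}) \<phi> x) =
      \<beta> * (t * a * (v2 - v1)) + (1 - \<beta>) * (B * (v2 - v1))"
    by (simp add: mult_ac)
  have "(\<Sum>x\<in>set_pmf \<sigma>. pmf \<sigma> x * expected_utility v1 v2 \<beta> (producer_utility {v1, v2}) \<phi> x) =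
      (\<Sum>x\<in>set_pmf \<sigma>. \<beta> * t * v1 * pmf \<sigma> x + (\<beta> * (1 - t) + (1 - \<beta>)) * v2 * (pmf \<sigma> x * pmf x v2) +
        (1 - \<beta>) * v1 * (pmf \<sigma> x * pmf (\<phi> x) v1) -
        (1 - \<beta>) * v2 * (pmf \<sigma> x * (pmf (\<phi> x) v1 * pmf x v2)))"
    by (rule sum.cong) (use sub phi in \<open>auto simp: expected_producer_utility algebra_simps\<close>)
  also have "\<dots> = \<beta> * t * v1 + (\<beta> * (1 - t) + (1 - \<beta>)) * v2 * a + (1 - \<beta>) * v1 * A -
      (1 - \<beta>) * v2 * B"
    by (simp add: A_def B_def sum.distrib sum_subtractf mean one flip: sum_distrib_left)
  finally show "(\<Sum>x\<in>set_pmf \<sigma>. pmf \<sigma> x * expected_utility v1 v2 \<beta> (producer_utility {v1, v2}) \<phi> x) =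
      \<beta> * (t * v1 + (1 - t) * a * v2) + (1 - \<beta>) * (A * v1 + (a - B) * v2)"
    by (simp add: algebra_simps)
qed

text \<open>Consumers offered \<open>v1\<close> come from segments with shares in [0, t], those
  offered \<open>v2\<close> from segments with shares in [t, 1]. Averaging with weights
  \<open>pmf (\<phi> x) v1\<close> and its complement gives the bounds.\<close>

lemma low_price_bounds:
  assumes a: "a \<in> {0..1}" and phi: "\<phi> \<in> optimal_pricing_rules v1 v2 \<beta>"
    and sigma: "\<sigma> \<in> segmentations {v1, v2} (market_of_share v1 v2 a)"
  defines "A \<equiv> low_price_mass \<phi> \<sigma>" and "B \<equiv> low_price_share \<phi> \<sigma>"
  shows "A \<in> {0..1}" "0 \<le> B" "B \<le> t * A" "t * (1 - A) \<le> a - B" "a - B \<le> 1 - A"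
proof -
  have fin: "finite (set_pmf \<sigma>)" and sub: "set_pmf \<sigma> \<subseteq> markets {v1, v2}"
    and mean: "(\<Sum>x\<in>set_pmf \<sigma>. pmf \<sigma> x * pmf x v2) = a"
    using sigma by (auto simp: segmentations_iff[OF a])
  have one: "(\<Sum>x\<in>set_pmf \<sigma>. pmf \<sigma> x) = 1"
    by (rule sum_pmf_eq_1[OF fin]) simp
  have rule: "pmf x v2 < t \<Longrightarrow> pmf (\<phi> x) v1 = 1" "t < pmf x v2 \<Longrightarrow> pmf (\<phi> x) v1 = 0"
    if "x \<in> set_pmf \<sigma>" for x
    using phi that sub by (auto simp: optimal_pricing_rules_iff)
  have high: "1 - A = (\<Sum>x\<in>set_pmf \<sigma>. pmf \<sigma> x * (1 - pmf (\<phi> x) v1))"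
    by (simp add: A_def low_price_mass_def algebra_simps sum_subtractf one)
  have high_share: "a - B = (\<Sum>x\<in>set_pmf \<sigma>. pmf \<sigma> x * ((1 - pmf (\<phi> x) v1) * pmf x v2))"
    by (simp add: B_def low_price_share_def left_diff_distrib right_diff_distrib sum_subtractf mean)
  have "0 \<le> 1 - A"
    unfolding high by (intro sum_nonneg) (simp add: pmf_le_1)
  then show "A \<in> {0..1}"
    by (simp add: A_def low_price_mass_def sum_nonneg)
  show "0 \<le> B"
    by (simp add: B_def low_price_share_def sum_nonneg)
  have "B \<le> (\<Sum>x\<in>set_pmf \<sigma>. pmf \<sigma> x * (t * pmf (\<phi> x) v1))"
    unfolding B_def low_price_share_def
  proof (intro sum_mono mult_left_mono)
    fix x assume "x \<in> set_pmf \<sigma>"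
    then show "pmf (\<phi> x) v1 * pmf x v2 \<le> t * pmf (\<phi> x) v1"
      \<comment> \<open>Above the threshold the weight on \<open>v1\<close> vanishes, so both sides
        are 0.\<close>
      using rule[of x] by (cases "pmf x v2 \<le> t") (auto simp: mult.commute mult_right_mono)
  qed simp
  then show "B \<le> t * A"
    by (simp add: A_def low_price_mass_def sum_distrib_left mult_ac)
  have "(\<Sum>x\<in>set_pmf \<sigma>. pmf \<sigma> x * (t * (1 - pmf (\<phi> x) v1))) \<le> a - B"
    unfolding high_share
  proof (intro sum_mono mult_left_mono)
    fix x assume "x \<in> set_pmf \<sigma>"
    then show "t * (1 - pmf (\<phi> x) v1) \<le> (1 - pmf (\<phi> x) v1) * pmf x v2"
      using rule[of x] mult_left_mono[of t "pmf x v2" "1 - pmf (\<phi> x) v1"]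
      by (cases "t \<le> pmf x v2") (auto simp: mult.commute pmf_le_1)
  qed simp
  then show "t * (1 - A) \<le> a - B"
    by (simp add: high sum_distrib_left mult_ac)
  show "a - B \<le> 1 - A"
    unfolding high high_share
    by (intro sum_mono mult_left_mono mult_left_le) (auto simp: pmf_le_1)
qed

section \<open>Reduction to two segments and their realization\<close>

lemma two_segment_decomposition:
  assumes A: "A \<in> {0..1}" and B: "0 \<le> B" "B \<le> t * A" "t * (1 - A) \<le> a - B" "a - B \<le> 1 - A"
  obtains a1 a2 where "a1 \<in> {0..min t a}" "a2 \<in> {max t a..1}"
    "A * a1 = B" "(1 - A) * a2 = a - B"
proof -
  consider "A = 0" | "A = 1" | "0 < A" "A < 1"
    using A by fastforce
  then show ?thesis
  proof cases
    \<comment> \<open>An empty group leaves its share undetermined: the witness is 0 for the low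
      side here and 1 for the high side in the next case. The bounds force the other share to be
      \<open>a\<close>.\<close>
    case 1
    then show ?thesis
      using B t_range by (intro that[of 0 a]) auto
  next
    case 2
    then show ?thesis
      using B t_range by (intro that[of a 1]) auto
  next
    case 3
    \<comment> \<open>These are the mean shares among consumers offered \<open>v1\<close> and
      \<open>v2\<close> respectively.\<close>
    define a1 a2 where "a1 = B / A" and "a2 = (a - B) / (1 - A)"
    have eq: "A * a1 = B" "(1 - A) * a2 = a - B"
      using 3 by (auto simp: a1_def a2_def)
    have bounds: "0 \<le> a1" "a1 \<le> t" "t \<le> a2" "a2 \<le> 1"
      using 3 B by (auto simp: a1_def a2_def field_simps)
    \<comment> \<open>As a convex combination of a1 \<le> a2, the number \<open>a\<close> lies
      between them; this supplies the bounds by \<open>a\<close> inside \<open>min\<close> and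
      \<open>max\<close>.\<close>
    have "a = A * a1 + (1 - A) * a2"
      using eq by simp
    moreover have "A * a1 \<le> A * a2" "(1 - A) * a1 \<le> (1 - A) * a2"
      using 3 bounds by (auto intro: mult_left_mono)
    ultimately have "a1 \<le> a" "a \<le> a2"
      by (auto simp: algebra_simps)
    then show ?thesis
      using bounds eq by (intro that[of a1 a2]) auto
  qed
qed

text \<open>If a1 < a2, at most one of the shares equals \<open>t\<close>, so the value of the rule
  at \<open>t\<close> can be set to price the first segment at \<open>v1\<close> and the second at
  \<open>v2\<close>.\<close>

lemma two_segment_realization:
  assumes a1: "a1 \<in> {0..t}" and a2: "a2 \<in> {t..1}" and g: "g \<in> {0..1}"
    and mean: "g * a1 + (1 - g) * a2 = a"
  obtains \<phi> \<sigma> where "\<phi> \<in> optimal_pricing_rules v1 v2 \<beta>"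
    "\<sigma> \<in> segmentations {v1, v2} (market_of_share v1 v2 a)"
    "low_price_mass \<phi> \<sigma> = g" "low_price_share \<phi> \<sigma> = g * a1"
proof -
  \<comment> \<open>If both shares equal \<open>t\<close>, the two segments coincide and the rule itself must randomize.\<close>
  define \<rho> where "\<rho> = (if a1 < t then 0 else if t < a2 then 1 else g)"
  define r where "r s = (if s < t then 1 else if t < s then 0 else \<rho>)" for s
  \<comment> \<open>The complement appears because \<open>r\<close> is the weight on
    \<open>v1\<close>, while \<open>market_of_share\<close> takes the weight on
    \<open>v2\<close>.\<close>
  define \<phi> where "\<phi> x = market_of_share v1 v2 (1 - r (pmf x v2))" for x
  define \<sigma> where "\<sigma> = map_pmf (\<lambda>b. if b then market_of_share v1 v2 a1 else market_of_share v1 v2 a2)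
    (bernoulli_pmf g)"
  note sum = sum_bernoulli_segments[OF g, of "market_of_share v1 v2 a1" "market_of_share v1 v2 a2", folded \<sigma>_def]
  \<comment> \<open>The second alternative arises when both shares equal \<open>t\<close>. Averaging
    the common weight \<open>g\<close> then still gives mass \<open>g\<close> and share
    \<open>g * a1\<close>.\<close>
  have r_eq: "r a1 = 1 \<and> r a2 = 0 \<or> r a1 = g \<and> r a2 = g \<and> a2 = a1"
    using a1 a2 by (auto simp: r_def \<rho>_def)
  have r01: "r s \<in> {0..1}" for s
    using g by (auto simp: r_def \<rho>_def)
  have phi2: "pmf (\<phi> x) v2 = 1 - r (pmf x v2)" for x
    using r01[of "pmf x v2"] by (simp add: \<phi>_def pmf_market_of_share)
  have phi1: "pmf (\<phi> x) v1 = r (pmf x v2)" for x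
    using phi2[of x] pmf_v1_eq[of "\<phi> x"] by (simp add: \<phi>_def market_of_share_in_markets)
  have "r \<in> borel_measurable borel"
    unfolding r_def by measurable
  then have "(\<lambda>x. r (pmf x v2)) \<in> borel_measurable (market_algebra v1 v2)"
    by (rule measurable_compose[OF measurable_share])
  then have "\<phi> \<in> optimal_pricing_rules v1 v2 \<beta>"
    unfolding optimal_pricing_rules_iff
    by (auto simp: phi1 phi2) (auto simp: \<phi>_def market_of_share_in_markets r_def)
  moreover have "a \<in> {0..1}"
  proof -
    have "g * a1 \<le> g * 1" "(1 - g) * a2 \<le> (1 - g) * 1" "0 \<le> g * a1" "0 \<le> (1 - g) * a2"
      using a1 a2 g t_range by (auto intro!: mult_left_mono mult_nonneg_nonneg simp del: mult_1_right)
    then show ?thesis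
      using mean by auto
  qed
  then have "\<sigma> \<in> segmentations {v1, v2} (market_of_share v1 v2 a)"
    using sum a1 a2 t_range mean
    by (auto simp: segmentations_iff pmf_market_of_share \<sigma>_def market_of_share_in_markets)
  moreover have "low_price_mass \<phi> \<sigma> = g * r a1 + (1 - g) * r a2"
    using sum(2) a1 a2 t_range by (simp add: low_price_mass_def phi1 pmf_market_of_share)
  then have "low_price_mass \<phi> \<sigma> = g"
    using r_eq by (auto simp: algebra_simps)
  moreover have "low_price_share \<phi> \<sigma> = g * (r a1 * a1) + (1 - g) * (r a2 * a2)"
    using sum(2)[of "\<lambda>x. r (pmf x v2) * pmf x v2"] a1 a2 t_range
    by (simp add: low_price_share_def phi1 pmf_market_of_share)
  then have "low_price_share \<phi> \<sigma> = g * a1"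
    using r_eq by (auto simp: algebra_simps)
  ultimately show ?thesis
    by (rule that)
qed

end

theorem proposition3:
  fixes v1 v2 \<eta> \<alpha>star \<beta> tstar :: real and S' :: "(real \<times> real) set"
  assumes "0 < v1" and "v1 < v2" and "\<eta> = v1 / v2"
    and "\<alpha>star \<in> {0..1}"
    and "\<beta> \<in> {0..<1}" and "\<beta> \<le> min (2 * \<eta>) (2 * (1 - \<eta>))"
    and "tstar = (\<eta> - \<beta> / 2) / (1 - \<beta>)"
    and "S' = {(\<gamma>1 * \<alpha>1 * (v2 - v1), \<gamma>1 * v1 + \<gamma>2 * \<alpha>2 * v2) | \<gamma>1 \<gamma>2 \<alpha>1 \<alpha>2.
                 \<alpha>1 \<in> {0..min tstar \<alpha>star} \<and> \<alpha>2 \<in> {max tstar \<alpha>star..1} \<and>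
                 \<gamma>1 \<in> {0..1} \<and> \<gamma>2 \<in> {0..1} \<and> \<gamma>1 + \<gamma>2 = 1 \<and>
                 \<gamma>1 * \<alpha>1 + \<gamma>2 * \<alpha>2 = \<alpha>star}"
  shows "achievable_utilities v1 v2 \<beta> (market_of_share v1 v2 \<alpha>star) =
           {\<beta> *\<^sub>R (tstar * \<alpha>star * (v2 - v1), tstar * v1 + (1 - tstar) * \<alpha>star * v2)
              + (1 - \<beta>) *\<^sub>R s' | s'. s' \<in> S'}"
    (is "?L = ?R")
proof -
  interpret noisy_two_values v1 v2 \<beta> tstar
    by unfold_locales (use assms in simp_all)
  show ?thesis
  proof (rule set_eqI, rule iffI)
    fix p assume "p \<in> ?L"
    then obtain \<sigma> \<phi> where sigma: "\<sigma> \<in> segmentations {v1, v2} (market_of_share v1 v2 \<alpha>star)"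
      and phi: "\<phi> \<in> optimal_pricing_rules v1 v2 \<beta>"
      and p: "p = (\<Sum>x\<in>set_pmf \<sigma>. pmf \<sigma> x * expected_utility v1 v2 \<beta> (consumer_utility {v1, v2}) \<phi> x,
        \<Sum>x\<in>set_pmf \<sigma>. pmf \<sigma> x * expected_utility v1 v2 \<beta> (producer_utility {v1, v2}) \<phi> x)"
      unfolding achievable_utilities_def by blast
    define A B where "A = low_price_mass \<phi> \<sigma>" and "B = low_price_share \<phi> \<sigma>"
    note bounds = low_price_bounds[OF assms(4) phi sigma, folded A_def B_def]
    obtain a1 a2 where a: "a1 \<in> {0..min tstar \<alpha>star}" "a2 \<in> {max tstar \<alpha>star..1}"
      and eq: "A * a1 = B" "(1 - A) * a2 = \<alpha>star - B"
      using two_segment_decomposition[OF bounds] .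
    \<comment> \<open>The weights are \<gamma>1 = A and \<gamma>2 = 1 - A; the two equations in
      \<open>eq\<close> add up to the mean constraint.\<close>
    have "(A * a1 * (v2 - v1), A * v1 + (1 - A) * a2 * v2) \<in> S'"
      unfolding assms(8) using a eq bounds(1) by fastforce
    moreover have "p = \<beta> *\<^sub>R (tstar * \<alpha>star * (v2 - v1), tstar * v1 + (1 - tstar) * \<alpha>star * v2)
        + (1 - \<beta>) *\<^sub>R (A * a1 * (v2 - v1), A * v1 + (1 - A) * a2 * v2)"
      unfolding p eq aggregate_utilities[OF assms(4) phi sigma] by (simp add: A_def B_def)
    ultimately show "p \<in> ?R"
      by blast
  next
    fix p assume "p \<in> ?R"
    then obtain g1 g2 a1 a2 where p: "p =
        \<beta> *\<^sub>R (tstar * \<alpha>star * (v2 - v1), tstar * v1 + (1 - tstar) * \<alpha>star * v2) +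
        (1 - \<beta>) *\<^sub>R (g1 * a1 * (v2 - v1), g1 * v1 + g2 * a2 * v2)"
      and a: "a1 \<in> {0..min tstar \<alpha>star}" "a2 \<in> {max tstar \<alpha>star..1}"
      and g: "g1 \<in> {0..1}" "g1 + g2 = 1" and mean: "g1 * a1 + g2 * a2 = \<alpha>star"
      unfolding assms(8) by blast
    have g2: "g2 = 1 - g1"
      using g by simp
    have a': "a1 \<in> {0..tstar}" "a2 \<in> {tstar..1}"
      using a by auto
    obtain \<phi> \<sigma> where phi: "\<phi> \<in> optimal_pricing_rules v1 v2 \<beta>"
      and sigma: "\<sigma> \<in> segmentations {v1, v2} (market_of_share v1 v2 \<alpha>star)"
      and mass: "low_price_mass \<phi> \<sigma> = g1" "low_price_share \<phi> \<sigma> = g1 * a1"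
      using two_segment_realization[OF a' g(1) mean[unfolded g2]] .
    have "g2 * a2 = \<alpha>star - g1 * a1"
      using mean by simp
    then have "p = (\<Sum>x\<in>set_pmf \<sigma>. pmf \<sigma> x * expected_utility v1 v2 \<beta> (consumer_utility {v1, v2}) \<phi> x,
        \<Sum>x\<in>set_pmf \<sigma>. pmf \<sigma> x * expected_utility v1 v2 \<beta> (producer_utility {v1, v2}) \<phi> x)"
      unfolding p aggregate_utilities[OF assms(4) phi sigma] mass by simp
    then show "p \<in> ?L"
      unfolding achievable_utilities_def using phi sigma by blast
  qed
qed

end
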